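(* Let $\bm e_x,\bm e_y,\bm e_z$ denote the basis of the orthogonal coordinate frame $Oxyz$ of $\mathbb{R}^3$. Define the navigation vector field $\bm F:\mathbb{R}^3\to\mathbb{R}^3$ by $$\bm F=F_x\bm e_x+F_y\bm e_y+F_z\bm e_z,\qquad F_x=x^2-y^2-z^2,\quad F_y=2xy,\quad F_z=2xz .$$ Then the following properties hold. 1) Given $a,b\in\mathbb{R}$ with $a^2+b^2\neq 0$, $\bm F$ lies in the plane $\Sigma_{ab}:=\{(x,y,z)\in\mathbb{R}^3: ay+bz=0\}$. Therefore, $\Sigma_{ab}$ is positively invariant with respect to the dynamics $\dot{\bm p}=\bm F(\bm p)$. Furthermore, the $x$-axis is positively invariant. 2) Every integral curve of $\bm F$ starting from the positive $x$-semiaxis will escape to infinity in a finite time. Every integral curve of $\bm F$ starting from all other initial conditions in $\mathbb{R}^3$ (except for the trivial case of the origin) will pass through the origin of the frame $Oxyz$, and its tangent vector at the origin points along the positive direction of the $x$-axis. 3) There is only one singular point of $\bm F$, that is, the origin, which is almost globally attractive with respect to the dynamics $\dot{\bm p}=\bm F(\bm p)$.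
   Context: A vector field $\bm F:\mathbb{R}^3\to\mathbb{R}^3$ is said to lie in a nonempty subspace $\Sigma\subseteq\mathbb{R}^3$ if $\bm F(\bm p)\in\Sigma$ for each point $\bm p\in\Sigma$. A set is positively invariant with respect to $\dot{\bm p}=\bm F(\bm p)$ if every trajectory with initial condition in the set stays in the set for $t\ge 0$. The positive $x$-semiaxis is $\{(x,0,0)\in\mathbb{R}^3:x>0\}$. A singular point of $\bm F$ is a point at which $\bm F$ vanishes. The origin is almost globally attractive if trajectories from all initial conditions outside a set of measure zero converge to it. *)

theory Defs
  imports "HOL-Analysis.Analysis"
begin

definition nav_field :: "real^3 \<Rightarrow> real^3" where
  "nav_field p =
     ((p$1)\<^sup>2 - (p$2)\<^sup>2 - (p$3)\<^sup>2) *\<^sub>R axis 1 1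
     + (2 * p$1 * p$2) *\<^sub>R axis 2 1
     + (2 * p$1 * p$3) *\<^sub>R axis 3 1"

definition lies_in :: "('a::real_vector \<Rightarrow> 'a) \<Rightarrow> 'a set \<Rightarrow> bool" where
  "lies_in F S \<longleftrightarrow> subspace S \<and> S \<noteq> {} \<and> (\<forall>p\<in>S. F p \<in> S)"

definition singular_point :: "('a \<Rightarrow> 'b::zero) \<Rightarrow> 'a \<Rightarrow> bool" where
  "singular_point F p \<longleftrightarrow> F p = 0"

text \<open>
  Trajectories start at time 0 and run forward in time, on a time interval that may be
  bounded or unbounded.  The values of a trajectory outside its interval are irrelevant.
\<close>

definition integral_curve ::
  "('a::real_normed_vector \<Rightarrow> 'a) \<Rightarrow> 'a \<Rightarrow> (real \<Rightarrow> 'a) \<Rightarrow> real set \<Rightarrow> bool" where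
  "integral_curve F p0 p I \<longleftrightarrow>
     is_interval I \<and> 0 \<in> I \<and> I \<subseteq> {0..} \<and> p 0 = p0 \<and>
     (\<forall>t\<in>I. (p has_vector_derivative F (p t)) (at t within I))"

text \<open>
  An integral curve that cannot be continued forward.  The degenerate interval containing
  only 0 is admitted in \<open>integral_curve\<close>, so by Zorn's lemma a maximal curve exists for
  every field and every initial condition, and statements about all maximal curves from a
  given point are never vacuous.
\<close>

definition maximal_integral_curve ::
  "('a::real_normed_vector \<Rightarrow> 'a) \<Rightarrow> 'a \<Rightarrow> (real \<Rightarrow> 'a) \<Rightarrow> real set \<Rightarrow> bool" where
  "maximal_integral_curve F p0 p I \<longleftrightarrow>
     integral_curve F p0 p I \<and>
     (\<forall>q J. integral_curve F p0 q J \<longrightarrow> I \<subseteq> J \<longrightarrow> (\<forall>t\<in>I. q t = p t) \<longrightarrow> J = I)"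

definition positively_invariant ::
  "('a::real_normed_vector \<Rightarrow> 'a) \<Rightarrow> 'a set \<Rightarrow> bool" where
  "positively_invariant F S \<longleftrightarrow>
     (\<forall>p0\<in>S. \<forall>p I. integral_curve F p0 p I \<longrightarrow> (\<forall>t\<in>I. p t \<in> S))"

definition escapes_in_finite_time :: "(real \<Rightarrow> 'a::real_normed_vector) \<Rightarrow> real set \<Rightarrow> bool" where
  "escapes_in_finite_time p I \<longleftrightarrow>
     (\<exists>T>0. I = {0..<T} \<and> filterlim p at_infinity (at_left T))"

text \<open>
  A singular point of a smooth field is not reached in finite time by any other trajectory,
  so a curve \<open>p\<close> defined on \<open>[0, \<infinity>)\<close> passes through such a point \<open>q\<close> only in the geometric
  sense: after an orientation-preserving change of parameter \<open>\<sigma>\<close> from \<open>[0, 1)\<close> onto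
  \<open>[0, \<infinity>)\<close>, it becomes a regular \<open>C\<^sup>1\<close> curve \<open>\<gamma>\<close> on the closed interval \<open>[0, 1]\<close> that is
  at \<open>q\<close> for parameter value 1.  Its tangent vector at \<open>q\<close> is then \<open>\<gamma>' 1\<close>, which is
  determined up to a positive factor.  In particular \<open>p\<close> tends to \<open>q\<close> at infinity.
\<close>

definition passes_through_with_tangent ::
  "(real \<Rightarrow> 'a::real_normed_vector) \<Rightarrow> 'a \<Rightarrow> 'a \<Rightarrow> bool" where
  "passes_through_with_tangent p q v \<longleftrightarrow>
     (\<exists>\<sigma> \<gamma> \<gamma>'.
        strict_mono_on {0..<1} \<sigma> \<and> \<sigma> ` {0..<1} = {0..} \<and>
        (\<forall>s\<in>{0..<1}. \<gamma> s = p (\<sigma> s)) \<and> \<gamma> 1 = q \<and>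
        (\<forall>s\<in>{0..1}. (\<gamma> has_vector_derivative \<gamma>' s) (at s within {0..1}) \<and> \<gamma>' s \<noteq> 0) \<and>
        continuous_on {0..1} \<gamma>' \<and>
        (\<exists>c>0. \<gamma>' (1::real) = c *\<^sub>R v))"

definition almost_globally_attractive ::
  "('a::euclidean_space \<Rightarrow> 'a) \<Rightarrow> 'a \<Rightarrow> bool" where
  "almost_globally_attractive F q \<longleftrightarrow>
     (\<exists>N \<in> null_sets lebesgue. \<forall>p0. p0 \<notin> N \<longrightarrow>
        (\<forall>p I. maximal_integral_curve F p0 p I \<longrightarrow> I = {0..} \<and> (p \<longlongrightarrow> q) at_top))"

definition plane_ab :: "real \<Rightarrow> real \<Rightarrow> (real^3) set" where
  "plane_ab a b = {p. a * p$2 + b * p$3 = 0}"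

definition x_axis :: "(real^3) set" where
  "x_axis = {p. p$2 = 0 \<and> p$3 = 0}"

definition positive_x_semiaxis :: "(real^3) set" where
  "positive_x_semiaxis = {p. p$1 > 0 \<and> p$2 = 0 \<and> p$3 = 0}"

end

theory Submission
  imports Defs "HOL-Real_Asymp.Real_Asymp"
begin

text \<open>
  On each half-plane bounded by the \<open>x\<close>-axis the field is the complex field \<open>w\<^sup>2\<close>, whose flow is
  a translation in the coordinate \<open>1/w\<close>.  Hence the trajectory from \<open>p0\<close> is
  \<open>(p0 - t|p0|\<^sup>2 e\<^sub>x) / E t\<close> with \<open>E t = 1 - 2 x0 t + |p0|\<^sup>2 t\<^sup>2\<close>.  For uniqueness, let \<open>h\<close> be the
  solution of \<open>h' = -2 x h\<close>, \<open>h 0 = 1\<close>, along an arbitrary trajectory \<open>p = (x, y, z)\<close>: then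
  \<open>h|p|\<^sup>2\<close> is constant, so \<open>h p\<close> is affine in \<open>t\<close>, and \<open>h\<close> itself is \<open>E\<close>.  A trajectory thus lives
  exactly as long as \<open>E\<close> is positive, which is forever unless \<open>p0\<close> is on the positive \<open>x\<close>-semiaxis.
\<close>

section \<open>Algebra of the field\<close>

abbreviation (input) ex :: "real^3" where "ex \<equiv> axis 1 1"

lemma inner_ex [simp]: "v \<bullet> ex = v $ 1" "ex \<bullet> v = v $ 1"
  by (simp_all add: inner_axis inner_commute[of ex])

lemma ex_nth [simp]: "ex $ 1 = 1" "ex $ 2 = 0" "ex $ 3 = 0"
  by (simp_all add: axis_def)

lemma inner_vec3: "(v::real^3) \<bullet> w = v$1 * w$1 + v$2 * w$2 + v$3 * w$3"
  by (simp add: inner_vec_def sum_3)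

text \<open>Symmetry about the x-axis leaves only \<open>v $ 1\<close> and
  \<open>v \<bullet> v\<close> as coefficients, so most later computations avoid
  coordinates.\<close>

lemma nav_field_eq: "nav_field v = (2 * v$1) *\<^sub>R v - (v \<bullet> v) *\<^sub>R ex"
  by (simp add: nav_field_def vec_eq_iff forall_3 inner_vec3 axis_def power2_eq_square algebra_simps)

text \<open>The counterpart of |w^2| = |w|^2; it makes the origin the only singular point.\<close>

lemma norm_nav_field: "norm (nav_field v) = (norm v)\<^sup>2"
proof -
  have "nav_field v \<bullet> nav_field v = (v \<bullet> v)\<^sup>2"
    by (simp add: nav_field_eq inner_diff_left inner_diff_right power2_eq_square algebra_simps)
  then show ?thesis
    by (simp add: norm_eq_sqrt_inner)
qed

lemma nav_field_eq_0_iff [simp]: "nav_field v = 0 \<longleftrightarrow> v = 0"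
  using norm_nav_field[of v] by (metis norm_eq_zero zero_eq_power2)

lemma nav_field_scaleR: "nav_field (c *\<^sub>R v) = c\<^sup>2 *\<^sub>R nav_field v"
  by (simp add: nav_field_eq power2_eq_square algebra_simps)

lemma integral_curve_mem_interval:
  assumes "integral_curve F p0 p I" "t \<in> I"
  shows "{0..t} \<subseteq> I"
  using assms unfolding integral_curve_def
  by (auto intro: mem_is_interval_1_I[of I 0 t])

section \<open>The explicit flow\<close>

text \<open>This is |1 - t w|^2 for the complex number w representing \<open>p0\<close> in its
  half-plane: the solution w / (1 - t w) is rewritten over a real denominator.\<close>

definition flow_denom :: "real^3 \<Rightarrow> real \<Rightarrow> real" where
  "flow_denom p0 t = 1 - 2 * p0$1 * t + (p0 \<bullet> p0) * t\<^sup>2"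

definition flow :: "real^3 \<Rightarrow> real \<Rightarrow> real^3" where
  "flow p0 t = (1 / flow_denom p0 t) *\<^sub>R (p0 - (t * (p0 \<bullet> p0)) *\<^sub>R ex)"

lemma inner_flow_numerator:
  "(p0 - (t * (p0 \<bullet> p0)) *\<^sub>R ex) \<bullet> (p0 - (t * (p0 \<bullet> p0)) *\<^sub>R ex) = (p0 \<bullet> p0) * flow_denom p0 t"
  by (simp add: flow_denom_def inner_diff_left inner_diff_right power2_eq_square algebra_simps)

lemma flow_has_vector_derivative:
  assumes "flow_denom p0 t \<noteq> 0"
  shows "(flow p0 has_vector_derivative nav_field (flow p0 t)) (at t within I)"
proof -
  define R where "R = p0 \<bullet> p0"
  define M where "M = p0 - (t * R) *\<^sub>R ex"
  define E where "E = flow_denom p0 t"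
  have E: "E \<noteq> 0" and M1: "M $ 1 = p0$1 - t * R" and MM: "M \<bullet> M = R * E"
    using assms inner_flow_numerator[of p0 t] by (simp_all add: E_def M_def R_def)
  have "((\<lambda>t. 1 / flow_denom p0 t) has_real_derivative (2 * M$1) / E\<^sup>2) (at t within I)"
    using E unfolding E_def flow_denom_def M1 R_def
    by (auto intro!: derivative_eq_intros simp: power2_eq_square field_simps)
  moreover have "((\<lambda>t. p0 - (t * R) *\<^sub>R ex) has_vector_derivative - (R *\<^sub>R ex)) (at t within I)"
    by (auto intro!: derivative_eq_intros)
  ultimately have "(flow p0 has_vector_derivative
      (1 / E) *\<^sub>R (- (R *\<^sub>R ex)) + ((2 * M$1) / E\<^sup>2) *\<^sub>R M) (at t within I)"
    unfolding flow_def[abs_def] E_def M_def R_def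
    by (intro has_vector_derivative_scaleR)
  \<comment> \<open>The field is homogeneous of degree 2, and \<open>MM\<close> cancels one of the
    two factors 1 / \<open>E\<close> in front of \<open>ex\<close>.\<close>
  moreover have "(1 / E) *\<^sub>R (- (R *\<^sub>R ex)) + ((2 * M$1) / E\<^sup>2) *\<^sub>R M = nav_field ((1 / E) *\<^sub>R M)"
    using E by (simp add: nav_field_scaleR nav_field_eq MM scaleR_diff_right power2_eq_square field_simps)
  ultimately show ?thesis
    by (simp add: flow_def E_def M_def R_def)
qed

section \<open>Uniqueness of trajectories\<close>

lemma has_real_derivative_const_on:
  fixes f :: "real \<Rightarrow> real"
  assumes "\<And>s. s \<in> {0..t} \<Longrightarrow> (f has_real_derivative 0) (at s within {0..t})" "s \<in> {0..t}"
  shows "f s = f 0"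
proof -
  obtain c where "\<And>s. s \<in> {0..t} \<Longrightarrow> f s = c"
    using has_field_derivative_zero_constant[OF convex_real_interval(5) assms(1)] by blast
  then show ?thesis
    using assms(2) by simp
qed

text \<open>Conserved quantities replace a Lipschitz estimate. Positivity comes for free, because
  the denominator is identified with an exponential.\<close>

lemma integral_curve_eq_flow:
  assumes p: "integral_curve nav_field p0 p I" and t: "t \<in> I"
  shows "flow_denom p0 t > 0" "p t = flow p0 t"
proof -
  have sub: "{0..t} \<subseteq> I" and p_0: "p 0 = p0" and "t \<ge> 0"
    using integral_curve_mem_interval[OF p t] p t unfolding integral_curve_def by auto
  have p': "(p has_vector_derivative nav_field (p s)) (at s within {0..t})" if "s \<in> {0..t}" for s
    using p that sub unfolding integral_curve_def
    by (meson has_vector_derivative_within_subset subsetD)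
  have D: "((\<lambda>s. p s $ i) has_real_derivative nav_field (p s) $ i) (at s within {0..t})"
    if "s \<in> {0..t}" for s i
    using bounded_linear.has_vector_derivative[OF bounded_linear_vec_nth p'[OF that]]
    by (simp add: has_real_derivative_iff_has_vector_derivative)
  have "continuous_on {0..t} (\<lambda>s. p s $ 1)"
    using D[of _ 1] by (meson DERIV_continuous continuous_on_eq_continuous_within)
  then obtain g where g: "\<And>s. s \<in> {0..t} \<Longrightarrow>
      (g has_real_derivative p s $ 1) (at s within {0..t})"
    by (metis antiderivative_continuous has_real_derivative_iff_has_vector_derivative)
  \<comment> \<open>An integrating factor: along the curve |p|^2 has derivative 2 x |p|^2, which the
    factor 2 in the exponent compensates.\<close>
  define h where "h s = exp (2 * (g 0 - g s))" for s
  define R where "R = p0 \<bullet> p0"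
  have h_0: "h 0 = 1" and h_pos: "h s > 0" for s
    by (simp_all add: h_def)
  have h': "(h has_real_derivative - 2 * p s $ 1 * h s) (at s within {0..t})" if "s \<in> {0..t}" for s
    unfolding h_def[abs_def] using g[OF that] by (auto intro!: derivative_eq_intros)
  have hR: "h s * (p s \<bullet> p s) = R" if s: "s \<in> {0..t}" for s
  proof -
    have "((\<lambda>s. h s * (p s \<bullet> p s)) has_real_derivative 0) (at s within {0..t})" if "s \<in> {0..t}" for s
      unfolding inner_vec3
      by (rule derivative_eq_intros h'[OF that] D[OF that] refl)+
        (simp add: nav_field_def axis_def power2_eq_square algebra_simps)
    from has_real_derivative_const_on[OF this s] show ?thesis
      by (simp add: h_0 p_0 R_def)
  qed
  \<comment> \<open>In (h p)' the terms with 2 x p cancel and \<open>hR\<close> turns the rest into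
    the constant vector -R \<open>ex\<close>.\<close>
  have h_p: "h s * p s $ i = p0 $ i - s * R * ex $ i" if s: "s \<in> {0..t}" for s i
  proof -
    have "((\<lambda>s. h s * p s $ i + s * R * ex $ i) has_real_derivative 0) (at s within {0..t})"
      if "s \<in> {0..t}" for s
      by (rule derivative_eq_intros h'[OF that] D[OF that] refl)+
        (simp add: nav_field_eq hR[OF that, symmetric] algebra_simps)
    from has_real_derivative_const_on[OF this s] show ?thesis
      by (simp add: h_0 p_0)
  qed
  \<comment> \<open>Now h' = -2 x h = -2 (x0 - s R), which is also the derivative of the
    denominator.\<close>
  have "h t = flow_denom p0 t"
  proof -
    have "((\<lambda>s. h s - flow_denom p0 s) has_real_derivative 0) (at s within {0..t})"
      if "s \<in> {0..t}" for s
    proof -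
      have "h s * p s $ 1 = p0 $ 1 - s * R"
        using h_p[OF that, of 1] by simp
      then show ?thesis
        unfolding flow_denom_def
        by - (rule derivative_eq_intros h'[OF that] refl | simp add: R_def algebra_simps)+
    qed
    from has_real_derivative_const_on[OF this, of t] show ?thesis
      using \<open>t \<ge> 0\<close> by (simp add: h_0 flow_denom_def)
  qed
  moreover have "h t *\<^sub>R p t = p0 - (t * R) *\<^sub>R ex"
    using h_p[of t] \<open>t \<ge> 0\<close> by (simp add: vec_eq_iff)
  then have "p t = (1 / h t) *\<^sub>R (p0 - (t * R) *\<^sub>R ex)"
    using h_pos[of t] by (metis divide_inverse_commute less_irrefl mult.right_neutral
        scaleR_one scaleR_scaleR right_inverse mult.commute)
  ultimately show "flow_denom p0 t > 0" "p t = flow p0 t"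
    using h_pos[of t] by (simp_all add: flow_def R_def)
qed

section \<open>Lifetime of maximal curves\<close>

text \<open>By uniqueness the curve agrees with the flow on \<open>I\<close>, so the flow on
  \<open>J\<close> continues it and maximality forces equality.\<close>

lemma maximal_integral_curve_interval:
  assumes p: "maximal_integral_curve nav_field p0 p I"
    and J: "is_interval J" "I \<subseteq> J" "J \<subseteq> {0..}" "\<And>t. t \<in> J \<Longrightarrow> flow_denom p0 t > 0"
  shows "I = J"
proof -
  have pI: "integral_curve nav_field p0 p I"
    using p by (simp add: maximal_integral_curve_def)
  have "integral_curve nav_field p0 (flow p0) J"
    unfolding integral_curve_def
  proof (intro conjI ballI)
    show "0 \<in> J" using pI J(2) by (auto simp: integral_curve_def)
    show "flow p0 0 = p0" by (simp add: flow_def flow_denom_def)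
    show "(flow p0 has_vector_derivative nav_field (flow p0 t)) (at t within J)" if "t \<in> J" for t
      using J(4)[OF that] by (intro flow_has_vector_derivative) simp
  qed (use J in auto)
  then show ?thesis
    using p J(2) integral_curve_eq_flow(2)[OF pI] unfolding maximal_integral_curve_def by metis
qed

text \<open>Off the axis the quadratic \<open>flow_denom p0\<close> thus has negative
  discriminant.\<close>

lemma inner_self_gt_fst:
  assumes "p0 \<notin> x_axis"
  shows "(p0$1)\<^sup>2 < p0 \<bullet> p0"
  using assms by (auto simp: x_axis_def inner_vec3 power2_eq_square[symmetric]
      add_pos_nonneg add_nonneg_pos sum_power2_gt_zero_iff add.assoc)

text \<open>The homogenized denominator, which is needed at \<open>u = 0\<close> for the point at infinity.\<close>

lemma homogeneous_denom_pos:
  assumes "p0 \<notin> positive_x_semiaxis" "p0 \<noteq> 0" "s \<ge> 0" "u \<ge> 0" "s + u > 0"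
  shows "u\<^sup>2 - 2 * p0$1 * s * u + (p0 \<bullet> p0) * s\<^sup>2 > 0"
proof -
  have R: "p0 \<bullet> p0 > 0" using assms by simp
  have eq: "u\<^sup>2 - 2 * p0$1 * s * u + (p0 \<bullet> p0) * s\<^sup>2
      = (u - p0$1 * s)\<^sup>2 + (p0 \<bullet> p0 - (p0$1)\<^sup>2) * s\<^sup>2"
    \<comment> \<open>Completing the square: for s > 0 the second summand is positive off the axis;
      on the negative semiaxis it vanishes and the first is positive.\<close>
    by (simp add: power2_eq_square algebra_simps)
  show ?thesis
  proof (cases "s = 0")
    case True
    then show ?thesis using assms by simp
  next
    case False
    then have s: "s > 0" using assms by simp
    show ?thesis
    proof (cases "p0 \<in> x_axis")
      case False
      then show ?thesis
        unfolding eq using inner_self_gt_fst[OF False] s by (intro add_nonneg_pos) auto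
    next
      case True
      then have "p0 $ 1 \<noteq> 0" "\<not> p0 $ 1 > 0" and i: "p0 \<bullet> p0 = (p0$1)\<^sup>2"
        using R assms(1) by (auto simp: x_axis_def positive_x_semiaxis_def inner_vec3 power2_eq_square)
      then have "p0$1 * s < 0" using s by (simp add: mult_neg_pos)
      then have "u - p0$1 * s > 0" using assms by linarith
      then show ?thesis unfolding eq unfolding i by simp
    qed
  qed
qed

lemma flow_denom_pos:
  assumes "p0 \<notin> positive_x_semiaxis" "t \<ge> 0"
  shows "flow_denom p0 t > 0"
proof (cases "p0 = 0")
  case True
  then show ?thesis by (simp add: flow_denom_def)
next
  case False
  then show ?thesis
    using homogeneous_denom_pos[of p0 t 1] assms by (simp add: flow_denom_def)
qed

lemma maximal_integral_curve_global:
  assumes "p0 \<notin> positive_x_semiaxis" "maximal_integral_curve nav_field p0 p I"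
  shows "I = {0..}" "\<And>t. t \<ge> 0 \<Longrightarrow> p t = flow p0 t"
proof -
  have pI: "integral_curve nav_field p0 p I"
    using assms by (simp add: maximal_integral_curve_def)
  show "I = {0..}"
    by (rule maximal_integral_curve_interval[OF assms(2)])
      (use pI flow_denom_pos[OF assms(1)] in \<open>auto simp: integral_curve_def is_interval_ci\<close>)
  then show "\<And>t. t \<ge> 0 \<Longrightarrow> p t = flow p0 t"
    using integral_curve_eq_flow(2)[OF pI] by simp
qed

section \<open>Convergence to the origin and the tangent there\<close>

text \<open>The numerator has degree one in t and the denominator degree two. This covers even the
  positive semiaxis, where the formula past the pole no longer continues the trajectory.\<close>

lemma flow_tendsto_0: "(flow p0 \<longlongrightarrow> 0) at_top"
proof (cases "p0 = 0")
  case True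
  then show ?thesis by (simp add: flow_def[abs_def])
next
  case False
  define R where "R = p0 \<bullet> p0"
  have R: "R > 0" using False by (simp add: R_def)
  have "((\<lambda>t. 1 / flow_denom p0 t) \<longlongrightarrow> 0) at_top" "((\<lambda>t. t * R / flow_denom p0 t) \<longlongrightarrow> 0) at_top"
    unfolding flow_denom_def R_def[symmetric] using R by real_asymp+
  then have "((\<lambda>t. (1 / flow_denom p0 t) *\<^sub>R p0 - (t * R / flow_denom p0 t) *\<^sub>R ex)
      \<longlongrightarrow> 0 *\<^sub>R p0 - 0 *\<^sub>R ex) at_top"
    by (intro tendsto_intros)
  then show ?thesis
    by (simp add: flow_def[abs_def] R_def scaleR_diff_right)
qed

text \<open>
  The reparametrization \<open>\<sigma> s = s/(1 - s)\<close> turns \<open>flow p0\<close> into \<open>(1 - s) N s / D s\<close>, with \<open>N\<close> and \<open>D\<close>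
  polynomial and \<open>|N|\<^sup>2 = |p0|\<^sup>2 D\<close>; its derivative simplifies to \<open>F (N s) / (D s)\<^sup>2\<close>.
\<close>

lemma flow_passes_through_origin:
  assumes p0: "p0 \<notin> positive_x_semiaxis" "p0 \<noteq> 0" and p: "\<And>t. t \<ge> 0 \<Longrightarrow> p t = flow p0 t"
  shows "passes_through_with_tangent p 0 ex"
proof -
  define R where "R = p0 \<bullet> p0"
  have R: "R > 0" using p0 by (simp add: R_def)
  define N where "N s = (1 - s) *\<^sub>R p0 - (s * R) *\<^sub>R ex" for s
  define D where "D s = (1 - s)\<^sup>2 - 2 * p0$1 * s * (1 - s) + R * s\<^sup>2" for s
  define \<sigma> where "\<sigma> s = s / (1 - s)" for s :: real
  define \<gamma> where "\<gamma> s = ((1 - s) / D s) *\<^sub>R N s" for s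
  define \<gamma>' where "\<gamma>' s = (1 / (D s)\<^sup>2) *\<^sub>R nav_field (N s)" for s
  have D: "D s > 0" if "s \<in> {0..1}" for s
    unfolding D_def R_def using that by (intro homogeneous_denom_pos p0) auto
  have NN: "N s \<bullet> N s = R * D s" for s
    by (simp add: N_def D_def inner_diff_left inner_diff_right R_def[symmetric]
        power2_eq_square algebra_simps)
  have N1: "N s $ 1 = (1 - s) * p0$1 - s * R" for s
    by (simp add: N_def)
  have "strict_mono_on {0..<1} \<sigma>"
    by (rule strict_mono_onI) (simp add: \<sigma>_def field_simps)
  moreover have "\<sigma> ` {0..<1} = {0..}"
  proof (intro equalityI subsetI)
    fix t :: real assume "t \<in> {0..}"
    then have "t / (1 + t) \<in> {0..<1}" "\<sigma> (t / (1 + t)) = t"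
      by (auto simp: \<sigma>_def field_simps)
    then show "t \<in> \<sigma> ` {0..<1}" by force
  qed (auto simp: \<sigma>_def divide_nonneg_pos)
  moreover have "\<gamma> s = p (\<sigma> s)" if s: "s \<in> {0..<1}" for s
  proof -
    have ne: "1 - s \<noteq> 0" and "\<sigma> s \<ge> 0" using s by (auto simp: \<sigma>_def)
    have s_eq: "\<sigma> s * (1 - s) = s"
      using ne by (simp add: \<sigma>_def)
    have "D s = (1 - s)\<^sup>2 - 2 * p0$1 * (\<sigma> s * (1 - s)) * (1 - s) + R * (\<sigma> s * (1 - s))\<^sup>2"
      by (simp only: D_def s_eq)
    also have "\<dots> = (1 - s)\<^sup>2 * flow_denom p0 (\<sigma> s)"
      by (simp add: flow_denom_def R_def power2_eq_square algebra_simps)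
    finally have "D s = (1 - s)\<^sup>2 * flow_denom p0 (\<sigma> s)" .
    moreover have "N s = (1 - s) *\<^sub>R (p0 - (\<sigma> s * R) *\<^sub>R ex)"
      using ne by (simp add: N_def \<sigma>_def scaleR_diff_right)
    ultimately show ?thesis
      using ne p[OF \<open>\<sigma> s \<ge> 0\<close>]
      by (simp add: \<gamma>_def flow_def R_def power2_eq_square)
  qed
  moreover have "\<gamma> 1 = 0"
    by (simp add: \<gamma>_def)
  moreover have "(\<gamma> has_vector_derivative \<gamma>' s) (at s within {0..1})" if s: "s \<in> {0..1}" for s
  proof -
    have Ds: "D s \<noteq> 0" using D[OF s] by simp
    have "((\<lambda>s. (1 - s) / D s) has_real_derivative (2 * N s $ 1 + D s) / (D s)\<^sup>2) (at s within {0..1})"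
    proof -
      have D': "(D has_real_derivative - 2 * (1 - s) - 2 * p0$1 * (1 - 2 * s) + 2 * R * s)
          (at s within {0..1})"
        unfolding D_def[abs_def] by (auto intro!: derivative_eq_intros simp: algebra_simps)
      have "- D s - (1 - s) * (- 2 * (1 - s) - 2 * p0$1 * (1 - 2 * s) + 2 * R * s) = 2 * N s $ 1 + D s"
        unfolding N1 D_def by (simp add: power2_eq_square algebra_simps)
      then show ?thesis
        using Ds by (auto intro!: derivative_eq_intros D' simp: power2_eq_square)
    qed
    moreover have "(N has_vector_derivative - p0 - R *\<^sub>R ex) (at s within {0..1})"
      unfolding N_def[abs_def] by (auto intro!: derivative_eq_intros)
    ultimately have "(\<gamma> has_vector_derivative
        ((1 - s) / D s) *\<^sub>R (- p0 - R *\<^sub>R ex) + ((2 * N s $ 1 + D s) / (D s)\<^sup>2) *\<^sub>R N s)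
        (at s within {0..1})"
      unfolding \<gamma>_def[abs_def] by (intro has_vector_derivative_scaleR)
    moreover have "((1 - s) / D s) *\<^sub>R (- p0 - R *\<^sub>R ex) = (1 / D s) *\<^sub>R (- N s - R *\<^sub>R ex)"
      by (simp add: N_def divide_inverse algebra_simps)
    \<comment> \<open>The multiples N / D cancel, and R / D = |N|^2 / D^2 by
      \<open>NN\<close>.\<close>
    moreover have "(1 / D s) *\<^sub>R (- N s - R *\<^sub>R ex) + ((2 * N s $ 1 + D s) / (D s)\<^sup>2) *\<^sub>R N s = \<gamma>' s"
      using Ds by (simp add: \<gamma>'_def nav_field_eq NN power2_eq_square add_divide_distrib
          scaleR_left_distrib scaleR_diff_right)
    ultimately show ?thesis by simp
  qed
  moreover have "\<gamma>' s \<noteq> 0" if "s \<in> {0..1}" for s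
    using D[OF that] NN[of s] R by (auto simp: \<gamma>'_def)
  moreover have "continuous_on {0..1} \<gamma>'"
    unfolding \<gamma>'_def nav_field_eq NN N1 using D unfolding D_def N_def
    by (intro continuous_intros) (auto simp: less_imp_neq[symmetric])
  \<comment> \<open>At s = 1, N is -R \<open>ex\<close> and D is R, and the field sends -R
    \<open>ex\<close> to R^2 \<open>ex\<close>.\<close>
  moreover have "\<gamma>' 1 = 1 *\<^sub>R ex"
    using R by (simp add: \<gamma>'_def nav_field_eq NN N1 N_def D_def power2_eq_square
        scaleR_left_diff_distrib[symmetric])
  ultimately show ?thesis
    unfolding passes_through_with_tangent_def
    by - (rule exI[of _ \<sigma>], rule exI[of _ \<gamma>], rule exI[of _ \<gamma>'], blast intro: zero_less_one)
qed

section \<open>Blow-up on the positive semiaxis\<close>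

text \<open>Here the denominator is (1 - x t)^2. Its double root 1 / x cannot lie in
  \<open>I\<close>, and maximality supplies all earlier times.\<close>

lemma positive_x_semiaxis_escapes:
  assumes p0: "p0 \<in> positive_x_semiaxis" and p: "maximal_integral_curve nav_field p0 p I"
  shows "escapes_in_finite_time p I"
proof -
  define x where "x = p0 $ 1"
  have x: "x > 0" and p0_eq: "p0 = x *\<^sub>R ex"
    using p0 by (auto simp: positive_x_semiaxis_def x_def vec_eq_iff forall_3 axis_def)
  have inner: "p0 \<bullet> p0 = x\<^sup>2"
    by (simp add: p0_eq power2_eq_square)
  have E: "flow_denom p0 t = (1 - x * t)\<^sup>2" for t
    unfolding flow_denom_def inner x_def[symmetric] by (simp add: power2_eq_square algebra_simps)
  have pI: "integral_curve nav_field p0 p I"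
    using p by (simp add: maximal_integral_curve_def)
  have "1 / x \<notin> I"
    using integral_curve_eq_flow(1)[OF pI, of "1/x"] x by (auto simp: E)
  have "I \<subseteq> {0..<1 / x}"
  proof
    fix t assume t: "t \<in> I"
    then have "1 / x \<notin> {0..t}"
      using integral_curve_mem_interval[OF pI t] \<open>1 / x \<notin> I\<close> by blast
    then show "t \<in> {0..<1 / x}"
      using t pI x by (auto simp: integral_curve_def)
  qed
  then have I: "I = {0..<1 / x}"
    by (rule maximal_integral_curve_interval[OF p is_interval_co])
      (use x in \<open>auto simp: E field_simps\<close>)
  have "filterlim (\<lambda>t. x / (1 - x * t)) at_top (at_left (1 / x))"
    using x by real_asymp
  then have "filterlim (\<lambda>t. norm (p t)) at_top (at_left (1 / x))"
  proof (rule filterlim_mono_eventually[OF _ order_refl order_refl])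
    have "\<forall>\<^sub>F t in at_left (1 / x). t \<in> {0<..<1 / x}"
      using x by (intro eventually_at_left_real) simp
    then show "\<forall>\<^sub>F t in at_left (1 / x). x / (1 - x * t) = norm (p t)"
    proof eventually_elim
      case (elim t)
      then have pos: "1 - x * t > 0" using x by (simp add: field_simps)
      have "p0 - (t * (p0 \<bullet> p0)) *\<^sub>R ex = (x * (1 - x * t)) *\<^sub>R ex"
        unfolding inner by (simp add: p0_eq power2_eq_square algebra_simps)
      then have "p t = (x / (1 - x * t)) *\<^sub>R ex"
        using integral_curve_eq_flow(2)[OF pI, of t] elim I pos
        by (simp add: flow_def E power2_eq_square)
      then show ?case using x pos by simp
    qed
  qed
  then have "filterlim p at_infinity (at_left (1 / x))"
    by (rule filterlim_norm_at_top_imp_at_infinity)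
  with I x show ?thesis
    unfolding escapes_in_finite_time_def by (intro exI[of _ "1 / x"]) simp
qed

section \<open>Invariant subspaces and the exceptional null set\<close>

text \<open>The flow only translates \<open>p0\<close> along \<open>ex\<close> and rescales, so
  every subspace containing \<open>ex\<close> is invariant.\<close>

lemma positively_invariant_nav_field:
  assumes "subspace S" "\<And>p0 s. p0 \<in> S \<Longrightarrow> p0 - s *\<^sub>R ex \<in> S"
  shows "positively_invariant nav_field S"
  unfolding positively_invariant_def
  by (simp add: integral_curve_eq_flow(2) flow_def subspace_scale assms)

lemma subspace_plane_ab: "subspace (plane_ab a b)"
proof -
  have "plane_ab a b = {p. vector [0, a, b] \<bullet> p = 0}"
    by (simp add: plane_ab_def inner_vec3)
  then show ?thesis
    by (simp add: subspace_hyperplane)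
qed

lemma subspace_x_axis: "subspace x_axis"
  by (auto simp: subspace_def x_axis_def)

lemma positive_x_semiaxis_null: "positive_x_semiaxis \<in> null_sets lebesgue"
proof -
  have "negligible {p :: real^3. axis 2 1 \<bullet> p = 0}"
    by (rule negligible_hyperplane) (simp add: axis_eq_0_iff)
  moreover have "positive_x_semiaxis \<subseteq> {p. axis 2 1 \<bullet> p = 0}"
    by (auto simp: positive_x_semiaxis_def inner_axis inner_commute)
  ultimately show ?thesis
    using negligible_subset negligible_iff_null_sets by blast
qed

theorem theorem1:
  shows
    "(\<forall>a b :: real. a\<^sup>2 + b\<^sup>2 \<noteq> 0 \<longrightarrow>
        lies_in nav_field (plane_ab a b) \<and> positively_invariant nav_field (plane_ab a b)) \<and>
     positively_invariant nav_field x_axis \<and>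
     (\<forall>p0 p I. p0 \<in> positive_x_semiaxis \<longrightarrow> maximal_integral_curve nav_field p0 p I \<longrightarrow>
        escapes_in_finite_time p I) \<and>
     (\<forall>p0 p I. p0 \<notin> positive_x_semiaxis \<longrightarrow> p0 \<noteq> 0 \<longrightarrow>
        maximal_integral_curve nav_field p0 p I \<longrightarrow>
        I = {0..} \<and> passes_through_with_tangent p 0 (axis 1 1)) \<and>
     {p. singular_point nav_field p} = {0} \<and>
     almost_globally_attractive nav_field 0"
proof (intro conjI allI impI)
  fix a b :: real
  show "lies_in nav_field (plane_ab a b)"
    unfolding lies_in_def
  proof (intro conjI ballI)
    fix p assume p: "p \<in> plane_ab a b"
    have "a * nav_field p $ 2 + b * nav_field p $ 3 = 2 * p$1 * (a * p$2 + b * p$3)"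
      by (simp add: nav_field_eq algebra_simps)
    with p show "nav_field p \<in> plane_ab a b"
      by (simp add: plane_ab_def)
  qed (use subspace_plane_ab[of a b] subspace_0 in auto)
  show "positively_invariant nav_field (plane_ab a b)"
    by (rule positively_invariant_nav_field[OF subspace_plane_ab]) (simp add: plane_ab_def axis_def)
next
  show "positively_invariant nav_field x_axis"
    by (rule positively_invariant_nav_field[OF subspace_x_axis]) (simp add: x_axis_def axis_def)
next
  show "escapes_in_finite_time p I"
    if "p0 \<in> positive_x_semiaxis" "maximal_integral_curve nav_field p0 p I" for p0 p I
    using that by (rule positive_x_semiaxis_escapes)
next
  fix p0 p I
  assume p: "p0 \<notin> positive_x_semiaxis" "p0 \<noteq> 0" "maximal_integral_curve nav_field p0 p I"
  show "I = {0..}"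
    by (rule maximal_integral_curve_global[OF p(1,3)])
  show "passes_through_with_tangent p 0 (axis 1 1)"
    using flow_passes_through_origin[OF p(1,2)] maximal_integral_curve_global(2)[OF p(1,3)] by blast
next
  show "{p. singular_point nav_field p} = {0}"
    by (auto simp: singular_point_def)
next
  \<comment> \<open>The origin is included, its trajectory being constant, so the positive semiaxis
    alone serves as the exceptional set.\<close>
  have "I = {0..} \<and> (p \<longlongrightarrow> 0) at_top"
    if p: "p0 \<notin> positive_x_semiaxis" "maximal_integral_curve nav_field p0 p I" for p0 p I
  proof
    show "I = {0..}"
      by (rule maximal_integral_curve_global[OF p])
    have "\<forall>\<^sub>F t in at_top. flow p0 t = p t"
      using eventually_ge_at_top[of 0] by eventually_elim (simp add: maximal_integral_curve_global(2)[OF p])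
    then show "(p \<longlongrightarrow> 0) at_top"
      using flow_tendsto_0 by (rule Lim_transform_eventually[rotated])
  qed
  then show "almost_globally_attractive nav_field 0"
    unfolding almost_globally_attractive_def using positive_x_semiaxis_null by blast
qed

end
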